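(* Let $S\subseteq\mathbb{N}^p$ be a strong affine semigroup minimally generated by $E\sqcup A$, where $E=\operatorname{Mult}(S)=\{e_1,\dots,e_t\}$ and $A=\operatorname{msg}(S)\setminus E=\{a_1,\dots,a_r\}\neq\emptyset$. Then the following monomials of $\mathbb{K}[x_1,\dots,x_t,y_1,\dots,y_r]$ are indispensable (for the semigroup ideal $I_S$): 1. $y_iy_j$ for $i,j\in\{1,\dots,r\}$ with $i\ne j$. 2. $y_i^2$ for any $i\in\{1,\dots,r\}$ such that $2a_i\notin\operatorname{Ap}(S,E)$. 3. $y_i^3$ for any $i\in\{1,\dots,r\}$ such that $2a_i\in\operatorname{Ap}(S,E)$. 4. $X^\omega y_j$ for any $j\in\{1,\dots,r\}$ and $\omega\in\operatorname{Hilb}(T_j)$. 5. $X^\omega y_j^2$ for any $j\in\{1,\dots,r\}$ with $2a_j\in\operatorname{Ap}(S,E)$ and $\omega\in\operatorname{Hilb}(T'_j)$. Moreover, they are the unique indispensable monomials involving at least one variable in $\{y_1,\dots,y_r\}$.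
   Context: Here $p\ge1$ and $\mathbb{N}$ is the set of non-negative integers. An affine semigroup $S\subseteq\mathbb{N}^p$ is a finitely generated submonoid of $\mathbb{N}^p$; $\operatorname{msg}(S)$ is its unique minimal generating set; $\mathcal{C}(S)$ is the set of points of $\mathbb{N}^p$ lying in the cone of non-negative real combinations of $\operatorname{msg}(S)$. The set of multiplicities $\operatorname{Mult}(S)\subseteq\operatorname{msg}(S)$ is the set of minimal elements of $S\setminus\{0\}$ for the order $x\le_{\mathcal{C}(S)}y\iff y-x\in\mathcal{C}(S)$. $S$ is strong if for all $x,y\in S\setminus\{0\}$ with $x\neq y$ there is $e\in\operatorname{Mult}(S)$ with $x+y-e\in S$. $\operatorname{Ap}(S,E)=\{s\in S\mid s-e\notin S\text{ for all }e\in E\}$. Let $\mathbb{K}$ be a field. The monomial $X^\alpha Y^\beta=x_1^{\alpha_1}\cdots x_t^{\alpha_t}y_1^{\beta_1}\cdots y_r^{\beta_r}$ has $S$-degree $\sum_{i=1}^t\alpha_ie_i+\sum_{i=1}^r\beta_ia_i$. The semigroup ideal $I_S\subset\mathbb{K}[x_1,\dots,x_t,y_1,\dots,y_r]$ is the ideal generated by all binomials $X^\alpha Y^\beta-X^\gamma Y^\delta$ whose two monomials have the same $S$-degree. It has minimal generating sets consisting of such binomials; a monomial is indispensable if it appears (as one of the two monomials of some binomial) in every minimal binomial generating set of $I_S$. For $m\in S$, $C_m$ is the set of monomials of $S$-degree $m$, and $\sharp$ denotes cardinality. For $j\in\{1,\dots,r\}$, $$T_j=\Big\{\alpha\in\mathbb{N}^t\mid\sharp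 C_{\sum_{i=1}^t\alpha_ie_i+a_j}\ge2\text{ and }\sharp C_{\sum_{i=1}^t\alpha_ie_i}=1\Big\},$$ $$T'_j=\Big\{\alpha\in\mathbb{N}^t\mid\sharp C_{\sum_{i=1}^t\alpha_ie_i+2a_j}\ge2\text{ and }\sharp C_{\sum_{i=1}^t\alpha_ie_i+a_j}=1\Big\}.$$ For $L\subseteq\mathbb{N}^l$, $\operatorname{Hilb}(L)$ denotes the (finite) set of minimal elements of $L$ for the componentwise partial order on $\mathbb{N}^l$. *)

theory Defs
  imports "HOL-Analysis.Analysis" "HOL-Library.Poly_Mapping"
begin

definition min_elems :: "('a \<Rightarrow> 'a \<Rightarrow> bool) \<Rightarrow> 'a set \<Rightarrow> 'a set" where
  "min_elems le L = {x \<in> L. \<forall>y\<in>L. le y x \<longrightarrow> y = x}"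

definition minimal_gens :: "('a set \<Rightarrow> 'a set) \<Rightarrow> 'a set \<Rightarrow> 'a set \<Rightarrow> bool" where
  "minimal_gens gen X G \<longleftrightarrow> gen G = X \<and> (\<forall>H. H \<subset> G \<longrightarrow> gen H \<noteq> X)"

text \<open>\<open>diff_mem x y M\<close> says that the difference \<open>x - y\<close>, computed in the ambient group
  \<open>\<int>\<^sup>p\<close>, belongs to \<open>M \<subseteq> \<nat>\<^sup>p\<close>. The subtraction on \<^typ>\<open>nat^'p\<close> truncates and
  must not be used here.\<close>

definition diff_mem :: "'a::plus \<Rightarrow> 'a \<Rightarrow> 'a set \<Rightarrow> bool" where
  "diff_mem x y M \<longleftrightarrow> (\<exists>z\<in>M. x = y + z)"


subsection \<open>Affine semigroups\<close>

definition is_submonoid :: "'a::monoid_add set \<Rightarrow> bool" where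
  "is_submonoid S \<longleftrightarrow> 0 \<in> S \<and> (\<forall>x\<in>S. \<forall>y\<in>S. x + y \<in> S)"

definition affine_semigroup :: "(nat^'p) set \<Rightarrow> bool" where
  "affine_semigroup S \<longleftrightarrow> (\<exists>G. finite G \<and> is_submonoid hull G = S)"

definition msg :: "(nat^'p) set \<Rightarrow> (nat^'p) set" where
  "msg S = (THE G. minimal_gens ((hull) is_submonoid) S G)"

definition real_vec :: "nat^'p \<Rightarrow> real^'p" where
  "real_vec v = (\<chi> i. real (v $ i))"

definition cone_pts :: "(nat^'p) set \<Rightarrow> (nat^'p) set" where
  "cone_pts S = {x. \<exists>c. (\<forall>g\<in>msg S. 0 \<le> c g) \<and>
                        real_vec x = (\<Sum>g\<in>msg S. c g *\<^sub>R real_vec g)}"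

definition cone_le :: "(nat^'p) set \<Rightarrow> nat^'p \<Rightarrow> nat^'p \<Rightarrow> bool" where
  "cone_le S x y \<longleftrightarrow> diff_mem y x (cone_pts S)"

definition Mult :: "(nat^'p) set \<Rightarrow> (nat^'p) set" where
  "Mult S = min_elems (cone_le S) (S - {0})"

definition strong :: "(nat^'p) set \<Rightarrow> bool" where
  "strong S \<longleftrightarrow> (\<forall>x\<in>S - {0}. \<forall>y\<in>S - {0}. x \<noteq> y \<longrightarrow> (\<exists>e\<in>Mult S. diff_mem (x + y) e S))"

definition Ap :: "(nat^'p) set \<Rightarrow> (nat^'p) set \<Rightarrow> (nat^'p) set" where
  "Ap S E = {s \<in> S. \<forall>e\<in>E. \<not> diff_mem s e S}"

text \<open>The description of \<^const>\<open>msg\<close> is legitimate: a submonoid of \<open>\<nat>\<^sup>p\<close> has exactly one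
  minimal generating set.\<close>

lemma is_submonoid_hull: "is_submonoid (is_submonoid hull G)"
  by (rule hull_in) (auto simp: is_submonoid_def)

lemma msg_ex1:
  fixes S :: "(nat^'p) set"
  assumes S: "is_submonoid S"
  shows "\<exists>!G. minimal_gens ((hull) is_submonoid) S G"
proof -
  define I where "I = {x \<in> S - {0}. \<forall>y\<in>S - {0}. \<forall>z\<in>S - {0}. x \<noteq> y + z}"
  have sub: "I \<subseteq> G" if G: "is_submonoid hull G = S" for G
  proof
    fix x assume x: "x \<in> I"
    show "x \<in> G"
    proof (rule ccontr)
      assume "x \<notin> G"
      moreover have "G \<subseteq> S" using hull_subset[of G is_submonoid] by (simp only: G)
      ultimately have "G \<subseteq> S - {x}" by blast
      moreover have "is_submonoid (S - {x})"
        unfolding is_submonoid_def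
      proof (intro conjI ballI)
        show "0 \<in> S - {x}" using S x by (auto simp: is_submonoid_def I_def)
        fix y z assume y: "y \<in> S - {x}" and z: "z \<in> S - {x}"
        have "y + z \<in> S" using S y z by (simp add: is_submonoid_def)
        moreover have "y + z \<noteq> x"
        proof (cases "y = 0 \<or> z = 0")
          case True
          then show ?thesis using y z by auto
        next
          case False
          then show ?thesis using x y z unfolding I_def by blast
        qed
        ultimately show "y + z \<in> S - {x}" by simp
      qed
      ultimately have "is_submonoid hull G \<subseteq> S - {x}" by (rule hull_minimal)
      then have "x \<notin> S" unfolding G by blast
      then show False using x by (simp add: I_def)
    qed
  qed
  have gen: "is_submonoid hull I = S"
  proof
    show "is_submonoid hull I \<subseteq> S" using S by (intro hull_minimal) (auto simp: I_def)
    have "x \<in> is_submonoid hull I" if "x \<in> S" for x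
      using that
    proof (induction "\<Sum>i\<in>UNIV. x $ i" arbitrary: x rule: less_induct)
      case less
      show ?case
      proof (cases "x = 0 \<or> x \<in> I")
        case True
        then show ?thesis
        proof
          assume "x = 0"
          then show ?thesis using is_submonoid_hull[of I] by (simp add: is_submonoid_def)
        qed (rule hull_inc)
      next
        case False
        then obtain y z where yz: "y \<in> S" "y \<noteq> 0" "z \<in> S" "z \<noteq> 0" "x = y + z"
          using less.prems unfolding I_def by auto
        have pos: "0 < (\<Sum>i\<in>UNIV. w $ i)" if "w \<noteq> 0" for w :: "nat^'p"
        proof (rule gr_zeroI)
          assume "(\<Sum>i\<in>UNIV. w $ i) = 0"
          then have "w $ i = 0" for i by simp
          then show False using that by (simp add: vec_eq_iff)
        qed
        have "y \<in> is_submonoid hull I" "z \<in> is_submonoid hull I"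
        proof -
          have "(\<Sum>i\<in>UNIV. x $ i) = (\<Sum>i\<in>UNIV. y $ i) + (\<Sum>i\<in>UNIV. z $ i)"
            by (simp only: yz(5) vector_add_component sum.distrib)
          then have "(\<Sum>i\<in>UNIV. y $ i) < (\<Sum>i\<in>UNIV. x $ i)"
            and "(\<Sum>i\<in>UNIV. z $ i) < (\<Sum>i\<in>UNIV. x $ i)"
            using pos[OF yz(2)] pos[OF yz(4)] by linarith+
          then show "y \<in> is_submonoid hull I" "z \<in> is_submonoid hull I"
            using less.hyps yz(1,3) by blast+
        qed
        then show ?thesis using is_submonoid_hull[of I] yz(5) by (simp add: is_submonoid_def)
      qed
    qed
    then show "S \<subseteq> is_submonoid hull I" by blast
  qed
  have min_I: "minimal_gens ((hull) is_submonoid) S I"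
    unfolding minimal_gens_def
  proof (intro conjI allI impI notI)
    show "is_submonoid hull I = S" by (rule gen)
    fix H assume "H \<subset> I" and "is_submonoid hull H = S"
    then show False using sub[of H] by (simp add: psubset_eq)
  qed
  show ?thesis
  proof (rule ex1I[of _ I])
    show "minimal_gens ((hull) is_submonoid) S I" by (rule min_I)
    fix G assume G: "minimal_gens ((hull) is_submonoid) S G"
    then have "I \<subseteq> G" by (intro sub) (simp add: minimal_gens_def)
    moreover have "\<not> I \<subset> G" using G gen by (auto simp only: minimal_gens_def)
    ultimately show "G = I" by (simp add: psubset_eq)
  qed
qed


subsection \<open>The semigroup ideal\<close>

text \<open>The monomial \<open>X\<^sup>\<alpha> Y\<^sup>\<beta>\<close> is represented by its exponent \<open>(\<alpha>, \<beta>)\<close>, and the polynomial ring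
  \<open>\<bbbK>[x\<^sub>1,\<dots>,x\<^sub>t,y\<^sub>1,\<dots>,y\<^sub>r]\<close> by the monoid algebra of \<open>\<nat>\<^sup>t \<times> \<nat>\<^sup>r\<close> over \<open>\<bbbK>\<close>. The finite
  types \<open>'t\<close> and \<open>'r\<close> index the two families of variables.\<close>

type_synonym ('t, 'r) mono = "(nat, 't) vec \<times> (nat, 'r) vec"
type_synonym ('t, 'r, 'k) mpol = "('t, 'r) mono \<Rightarrow>\<^sub>0 'k"

definition comb :: "('n::finite \<Rightarrow> nat^'p) \<Rightarrow> nat^'n \<Rightarrow> nat^'p" where
  "comb g \<alpha> = (\<Sum>i\<in>UNIV. \<alpha> $ i *s g i)"

definition sdeg :: "('t::finite \<Rightarrow> nat^'p) \<Rightarrow> ('r::finite \<Rightarrow> nat^'p) \<Rightarrow> ('t, 'r) mono \<Rightarrow> nat^'p" where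
  "sdeg e a u = comb e (fst u) + comb a (snd u)"

definition monos_of_deg ::
    "('t::finite \<Rightarrow> nat^'p) \<Rightarrow> ('r::finite \<Rightarrow> nat^'p) \<Rightarrow> nat^'p \<Rightarrow> ('t, 'r) mono set" where
  "monos_of_deg e a m = {u. sdeg e a u = m}"

definition binomials ::
    "('t::finite \<Rightarrow> nat^'p) \<Rightarrow> ('r::finite \<Rightarrow> nat^'p) \<Rightarrow> ('t, 'r, 'k::field) mpol set" where
  "binomials e a =
     {Poly_Mapping.single u 1 - Poly_Mapping.single v 1 | u v. sdeg e a u = sdeg e a v}"

text \<open>An ideal of a commutative ring is a submodule of the ring over itself.\<close>

lemma module_times: "module ((*) :: 'a::comm_ring_1 \<Rightarrow> 'a \<Rightarrow> 'a)"
  by standard (simp_all add: algebra_simps)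

definition ideal_gen :: "'a::comm_ring_1 set \<Rightarrow> 'a set" where
  "ideal_gen B = module.span (*) B"

definition semigroup_ideal ::
    "('t::finite \<Rightarrow> nat^'p) \<Rightarrow> ('r::finite \<Rightarrow> nat^'p) \<Rightarrow> ('t, 'r, 'k::field) mpol set" where
  "semigroup_ideal e a = ideal_gen (binomials e a)"

text \<open>A minimal generating set does not contain the zero binomial, and the monomials of
  a nonzero binomial are the members of its \<^const>\<open>Poly_Mapping.keys\<close>. The first argument only
  fixes the coefficient field.\<close>

definition indispensable ::
    "'k::field itself \<Rightarrow> ('t::finite \<Rightarrow> nat^'p) \<Rightarrow> ('r::finite \<Rightarrow> nat^'p) \<Rightarrow> ('t, 'r) mono \<Rightarrow> bool" where
  "indispensable _ e a u \<longleftrightarrow>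
     (\<forall>B :: ('t, 'r, 'k) mpol set. B \<subseteq> binomials e a \<and> minimal_gens ideal_gen (semigroup_ideal e a) B
        \<longrightarrow> (\<exists>b\<in>B. u \<in> Poly_Mapping.keys b))"


subsection \<open>The exponent sets\<close>

definition Hilb :: "(nat^'l) set \<Rightarrow> (nat^'l) set" where
  "Hilb L = min_elems (\<le>) L"

definition T_set ::
    "('t::finite \<Rightarrow> nat^'p) \<Rightarrow> ('r::finite \<Rightarrow> nat^'p) \<Rightarrow> 'r \<Rightarrow> (nat^'t) set" where
  "T_set e a j = {\<alpha>. card (monos_of_deg e a (comb e \<alpha> + a j)) \<ge> 2 \<and>
                     card (monos_of_deg e a (comb e \<alpha>)) = 1}"

definition T'_set ::
    "('t::finite \<Rightarrow> nat^'p) \<Rightarrow> ('r::finite \<Rightarrow> nat^'p) \<Rightarrow> 'r \<Rightarrow> (nat^'t) set" where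
  "T'_set e a j = {\<alpha>. card (monos_of_deg e a (comb e \<alpha> + 2 *s a j)) \<ge> 2 \<and>
                      card (monos_of_deg e a (comb e \<alpha> + a j)) = 1}"

end

theory Submission
  imports Defs
begin

text \<open>Call a monomial ambiguous if another monomial has the same \<open>S\<close>-degree. The ambiguous monomials
  are closed under multiples, and the indispensable monomials are exactly the minimal ones for
  divisibility: a binomial containing a minimal ambiguous \<open>u\<close> can only be generated by
  binomials one of which contains \<open>u\<close>, whereas a non-minimal \<open>u = v w\<close> can be detoured through
  \<open>v' w\<close>, where \<open>v'\<close> has the same degree as \<open>v\<close>.

  In a strong semigroup, \<open>y\<^sub>i y\<^sub>j\<close> with \<open>i \<noteq> j\<close> and \<open>y\<^sub>i\<^sup>3\<close> are ambiguous, because their degrees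
  are sums of two distinct nonzero elements and hence involve some multiplicity. A minimal
  ambiguous monomial in which some \<open>y\<^sub>j\<close> occurs is therefore one of these or of the form
  \<open>X\<^sup>\<omega> y\<^sub>j\<close> or \<open>X\<^sup>\<omega> y\<^sub>j\<^sup>2\<close>.\<close>

section \<open>Dickson's lemma\<close>

text \<open>Dickson's lemma in the form "every sequence has a subsequence that is a divisibility
  chain". Passing to successive subsequences carries this form from \<open>nat\<close> to vectors
  and products, so the instances reach pairs of monomials.\<close>

class dickson_monoid = comm_monoid_add +
  assumes divisibility_chain:
    "\<exists>r::nat \<Rightarrow> nat. strict_mono r \<and> (\<forall>i j. i \<le> j \<longrightarrow> (\<exists>w. s (r j) = s (r i) + w))"

instance nat :: dickson_monoid
proof
  fix s :: "nat \<Rightarrow> nat"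
  obtain r :: "nat \<Rightarrow> nat" where r: "strict_mono r" and mono: "monoseq (\<lambda>n. s (r n))"
    using seq_monosub by blast
  from mono have "\<exists>k. \<forall>i j. i \<le> j \<longrightarrow> s (r (i + k)) \<le> s (r (j + k))"
    unfolding monoseq_def
  proof
    assume "\<forall>m. \<forall>n\<ge>m. s (r m) \<le> s (r n)"
    then show ?thesis by (intro exI[of _ 0]) simp
  next
    assume anti: "\<forall>m. \<forall>n\<ge>m. s (r n) \<le> s (r m)"
    \<comment> \<open>A decreasing sequence of naturals is constant from an index \<open>k\<close>
      where its minimum is attained, so dropping the first \<open>k\<close> terms leaves an
      increasing one.\<close>
    define k where "k = (ARG_MIN (\<lambda>n. s (r n)) n. True)"
    have "s (r k) \<le> s (r n)" for n
      unfolding k_def by (rule arg_min_nat_le) simp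
    then have "s (r (i + k)) \<le> s (r (j + k))" for i j
      using anti by (meson le_add2 order_trans)
    then show ?thesis by blast
  qed
  then obtain k where "\<forall>i j. i \<le> j \<longrightarrow> s (r (i + k)) \<le> s (r (j + k))" by blast
  moreover have "strict_mono (\<lambda>n. r (n + k))"
    using r by (simp add: strict_mono_def)
  ultimately show "\<exists>r::nat \<Rightarrow> nat. strict_mono r \<and> (\<forall>i j. i \<le> j \<longrightarrow> (\<exists>w. s (r j) = s (r i) + w))"
    by (meson le_iff_add)
qed

instance prod :: (dickson_monoid, dickson_monoid) dickson_monoid
proof
  fix s :: "nat \<Rightarrow> 'a \<times> 'b"
  obtain r :: "nat \<Rightarrow> nat" where r: "strict_mono r" "\<And>i j. i \<le> j \<Longrightarrow> \<exists>w. fst (s (r j)) = fst (s (r i)) + w"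
    using divisibility_chain[of "\<lambda>n. fst (s n)"] by blast
  obtain r' :: "nat \<Rightarrow> nat" where r': "strict_mono r'"
      "\<And>i j. i \<le> j \<Longrightarrow> \<exists>w. snd (s (r (r' j))) = snd (s (r (r' i))) + w"
    using divisibility_chain[of "\<lambda>n. snd (s (r n))"] by blast
  have "\<exists>w. s (r (r' j)) = s (r (r' i)) + w" if ij: "i \<le> j" for i j
  proof -
    obtain x where "fst (s (r (r' j))) = fst (s (r (r' i))) + x"
      using r(2)[of "r' i" "r' j"] ij r'(1) by (auto simp: strict_mono_less_eq)
    moreover obtain y where "snd (s (r (r' j))) = snd (s (r (r' i))) + y"
      using r'(2)[OF ij] by blast
    ultimately have "s (r (r' j)) = s (r (r' i)) + (x, y)"
      by (simp add: prod_eq_iff)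
    then show ?thesis ..
  qed
  moreover have "strict_mono (\<lambda>n. r (r' n))"
    using r(1) r'(1) by (simp add: strict_mono_def)
  ultimately show "\<exists>r::nat \<Rightarrow> nat. strict_mono r \<and> (\<forall>i j. i \<le> j \<longrightarrow> (\<exists>w. s (r j) = s (r i) + w))"
    by (intro exI[of _ "\<lambda>n. r (r' n)"]) simp
qed

instance vec :: (dickson_monoid, finite) dickson_monoid
proof
  fix s :: "nat \<Rightarrow> 'a^'b"
  \<comment> \<open>\<open>I\<close> collects the coordinates already made monotone; each new
    coordinate costs one more refinement, which preserves the earlier chains.\<close>
  have "\<exists>r::nat \<Rightarrow> nat. strict_mono r \<and>
      (\<forall>k\<in>I. \<forall>i j. i \<le> j \<longrightarrow> (\<exists>w. s (r j) $ k = s (r i) $ k + w))" for I :: "'b set"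
    using finite[of I]
  proof (induction I)
    case empty
    show ?case by (intro exI[of _ "\<lambda>n. n"]) (simp add: strict_mono_def)
  next
    case (insert k I)
    then obtain r :: "nat \<Rightarrow> nat" where r: "strict_mono r"
        "\<And>k i j. k \<in> I \<Longrightarrow> i \<le> j \<Longrightarrow> \<exists>w. s (r j) $ k = s (r i) $ k + w"
      by blast
    obtain r' :: "nat \<Rightarrow> nat" where r': "strict_mono r'"
        "\<And>i j. i \<le> j \<Longrightarrow> \<exists>w. s (r (r' j)) $ k = s (r (r' i)) $ k + w"
      using divisibility_chain[of "\<lambda>n. s (r n) $ k"] by blast
    have "strict_mono (\<lambda>n. r (r' n))"
      using r(1) r'(1) by (simp add: strict_mono_def)
    moreover have "\<exists>w. s (r (r' j)) $ l = s (r (r' i)) $ l + w" if "l \<in> insert k I" "i \<le> j" for l i j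
      using r(2)[of l "r' i" "r' j"] r'(2)[of i j] r'(1) that by (auto simp: strict_mono_less_eq)
    ultimately show ?case
      by (intro exI[of _ "\<lambda>n. r (r' n)"]) simp
  qed
  then obtain r :: "nat \<Rightarrow> nat" where r: "strict_mono r"
      "\<And>k i j. i \<le> j \<Longrightarrow> \<exists>w. s (r j) $ k = s (r i) $ k + w"
    by (metis UNIV_I)
  have "\<exists>w. s (r j) = s (r i) + w" if ij: "i \<le> j" for i j
  proof -
    obtain w where "\<And>k. s (r j) $ k = s (r i) $ k + w k"
      using r(2)[OF ij] by metis
    then have "s (r j) = s (r i) + (\<chi> k. w k)" by (simp add: vec_eq_iff)
    then show ?thesis ..
  qed
  then show "\<exists>r::nat \<Rightarrow> nat. strict_mono r \<and> (\<forall>i j. i \<le> j \<longrightarrow> (\<exists>w. s (r j) = s (r i) + w))"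
    using r(1) by blast
qed

text \<open>Infinitely many minimal elements would form an injective sequence; in a chain extracted
  from it, one term divides a later one, and minimality makes the two equal.\<close>

lemma finite_divisibility_minimal:
  fixes P :: "'a::dickson_monoid set"
  shows "finite {p \<in> P. \<forall>q\<in>P. \<forall>w. p = q + w \<longrightarrow> w = 0}" (is "finite ?M")
proof (rule ccontr)
  assume "infinite ?M"
  then obtain s :: "nat \<Rightarrow> 'a" where s: "inj s" "range s \<subseteq> ?M"
    using infinite_countable_subset[of ?M] by auto
  obtain r :: "nat \<Rightarrow> nat" where r: "strict_mono r" "\<And>i j. i \<le> j \<Longrightarrow> \<exists>w. s (r j) = s (r i) + w"
    using divisibility_chain[of s] by blast
  obtain w where w: "s (r 1) = s (r 0) + w" using r(2)[of 0 1] by auto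
  moreover have "s (r 1) \<in> ?M" "s (r 0) \<in> P" using s(2) by blast+
  ultimately have "w = 0" by blast
  then have "r 1 = r 0" using w s(1) by (simp add: inj_eq)
  then show False using r(1) by (simp add: strict_mono_eq)
qed

section \<open>Ideals\<close>

interpretation ring_module: module "(*) :: 'a::comm_ring_1 \<Rightarrow> 'a \<Rightarrow> 'a"
  by (rule module_times)

lemma ideal_gen_superset: "B \<subseteq> ideal_gen B"
  unfolding ideal_gen_def by (rule ring_module.span_superset)

lemma ideal_gen_mono: "A \<subseteq> B \<Longrightarrow> ideal_gen A \<subseteq> ideal_gen B"
  unfolding ideal_gen_def by (rule ring_module.span_mono)

lemma ideal_gen_add: "p \<in> ideal_gen B \<Longrightarrow> q \<in> ideal_gen B \<Longrightarrow> p + q \<in> ideal_gen B"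
  unfolding ideal_gen_def by (rule ring_module.span_add)

lemma ideal_gen_mult: "p \<in> ideal_gen B \<Longrightarrow> c * p \<in> ideal_gen B"
  unfolding ideal_gen_def by (rule ring_module.span_scale)

lemma ideal_gen_least: "A \<subseteq> ideal_gen B \<Longrightarrow> ideal_gen A \<subseteq> ideal_gen B"
  unfolding ideal_gen_def by (intro ring_module.span_minimal ring_module.subspace_span)

lemma ideal_gen_finite_support:
  assumes "p \<in> ideal_gen B"
  shows "\<exists>F. finite F \<and> F \<subseteq> B \<and> p \<in> ideal_gen F"
proof -
  obtain F c where F: "finite F" "F \<subseteq> B" and p: "p = (\<Sum>b\<in>F. c b * b)"
    using assms unfolding ideal_gen_def ring_module.span_explicit by blast
  have "p \<in> ideal_gen F"
    unfolding p ideal_gen_def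
    by (intro ring_module.span_sum ring_module.span_scale ring_module.span_base)
  then show ?thesis using F by blast
qed

text \<open>Each element of \<open>F\<close> needs only finitely many members of \<open>B\<close>.
  Their union is a finite generating subset of the possibly infinite \<open>B\<close>, and among its
  generating subsets one is minimal for inclusion.\<close>

lemma minimal_gens_subset_exists:
  assumes "finite F" and "ideal_gen F = ideal_gen B"
  shows "\<exists>G\<subseteq>B. minimal_gens ideal_gen (ideal_gen B) G"
proof -
  have "\<exists>T. finite T \<and> T \<subseteq> B \<and> f \<in> ideal_gen T" if "f \<in> F" for f
    using ideal_gen_finite_support[of f B] ideal_gen_superset[of F] assms(2) that by blast
  then obtain T where T: "\<And>f. f \<in> F \<Longrightarrow> finite (T f) \<and> T f \<subseteq> B \<and> f \<in> ideal_gen (T f)"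
    by metis
  let ?U = "\<Union>f\<in>F. T f"
  have "F \<subseteq> ideal_gen ?U" using T ideal_gen_mono[of "T _" ?U] by blast
  then have "ideal_gen ?U = ideal_gen B"
    using ideal_gen_least[of F ?U] ideal_gen_mono[of ?U B] T assms(2) by blast
  moreover define A where "A = {G \<in> Pow ?U. ideal_gen G = ideal_gen B}"
  ultimately have "?U \<in> A" by simp
  moreover have "finite ?U" "?U \<subseteq> B" using T assms(1) by blast+
  then have "finite A" by (simp add: A_def)
  ultimately obtain G where G: "G \<in> A" and min: "\<forall>H\<in>A. H \<subseteq> G \<longrightarrow> G = H"
    using finite_has_minimal2[of A ?U] by auto
  have "ideal_gen H \<noteq> ideal_gen B" if "H \<subset> G" for H
    using min[THEN bspec, of H] G that by (auto simp: A_def)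
  then have "minimal_gens ideal_gen (ideal_gen B) G"
    unfolding minimal_gens_def using G by (simp add: A_def)
  moreover have "G \<subseteq> B" using G \<open>?U \<subseteq> B\<close> by (auto simp: A_def)
  ultimately show ?thesis by blast
qed

text \<open>Multiplication only produces multiples of the monomials of a generator, and addition can
  cancel monomials but never create new ones.\<close>

lemma keys_ideal_gen:
  fixes B :: "('m::comm_monoid_add \<Rightarrow>\<^sub>0 'k::comm_ring_1) set"
  assumes "p \<in> ideal_gen B" and "u \<in> Poly_Mapping.keys p"
  shows "\<exists>b\<in>B. \<exists>v\<in>Poly_Mapping.keys b. \<exists>w. u = v + w"
  using assms unfolding ideal_gen_def
proof (induction p arbitrary: u rule: ring_module.span_induct_alt)
  case base
  then show ?case by simp
next
  case (step c b q)
  then have "u \<in> Poly_Mapping.keys (c * b) \<or> u \<in> Poly_Mapping.keys q"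
    using keys_add[of "c * b" q] by blast
  then show ?case
  proof
    assume "u \<in> Poly_Mapping.keys (c * b)"
    then obtain w v where "u = w + v" "v \<in> Poly_Mapping.keys b"
      using keys_mult[of c b] by blast
    then have "u = v + w" by (simp add: add.commute)
    then show ?thesis using step.hyps \<open>v \<in> Poly_Mapping.keys b\<close> by blast
  qed (rule step.IH)
qed

section \<open>Degrees\<close>

text \<open>Measures exponent vectors and semigroup elements alike. Comparing the two in
  \<open>weight_le_comb\<close> bounds the monomials of a given degree.\<close>

definition weight :: "nat^'n \<Rightarrow> nat" where
  "weight v = (\<Sum>i\<in>UNIV. v $ i)"

lemma weight_zero [simp]: "weight 0 = 0"
  by (simp add: weight_def)

lemma weight_add: "weight (v + w) = weight v + weight w"
  by (simp add: weight_def sum.distrib)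

lemma weight_eq_0_iff [simp]: "weight v = 0 \<longleftrightarrow> v = 0"
  by (simp add: weight_def vec_eq_iff)

lemma component_le_weight: "v $ i \<le> weight v"
  unfolding weight_def by (rule member_le_sum) auto

lemma finite_weight_le: "finite {v :: nat^'n. weight v \<le> N}"
proof (rule finite_subset)
  show "{v :: nat^'n. weight v \<le> N} \<subseteq> vec_lambda ` (UNIV \<rightarrow>\<^sub>E {..N})"
  proof
    fix v :: "nat^'n" assume "v \<in> {v. weight v \<le> N}"
    then have "vec_nth v \<in> UNIV \<rightarrow>\<^sub>E {..N}"
      using component_le_weight[of v] by (auto intro: order_trans)
    then show "v \<in> vec_lambda ` (UNIV \<rightarrow>\<^sub>E {..N})"
      by (metis image_eqI vec_nth_inverse)
  qed
qed (simp add: finite_PiE)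

lemma nat_vec_add_eq_0_iff: "v + w = 0 \<longleftrightarrow> v = 0 \<and> w = 0" for v w :: "nat^'n"
  by (auto simp: vec_eq_iff)

lemma nat_vec_split_axis:
  fixes v :: "nat^'n"
  assumes "v \<noteq> 0"
  shows "\<exists>k w. v = w + axis k 1"
proof -
  obtain k where "v $ k \<noteq> 0" using assms by (auto simp: vec_eq_iff)
  \<comment> \<open>The truncated subtraction is exact because the \<open>k\<close>-th entry is
    positive.\<close>
  then have "v = (v - axis k 1) + axis k 1"
    by (auto simp: vec_eq_iff axis_def)
  then show ?thesis by blast
qed

lemma mono_split_axis:
  fixes u :: "('t::finite, 'r::finite) mono"
  assumes "u \<noteq> 0"
  obtains (X) k w where "u = w + (axis k 1, 0)" | (Y) k w where "u = w + (0, axis k 1)"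
proof (cases "fst u = 0")
  case True
  then have "snd u \<noteq> 0" using assms by (auto simp: prod_eq_iff)
  then obtain k w where "snd u = w + axis k 1" using nat_vec_split_axis by blast
  then have "u = (fst u, w) + (0, axis k 1)" by (simp add: prod_eq_iff)
  then show ?thesis using Y by blast
next
  case False
  then obtain k w where "fst u = w + axis k 1" using nat_vec_split_axis by blast
  then have "u = (w, snd u) + (axis k 1, 0)" by (simp add: prod_eq_iff)
  then show ?thesis using X by blast
qed

lemma comb_zero [simp]: "comb g 0 = 0"
  by (simp add: comb_def)

lemma comb_add: "comb g (\<alpha> + \<beta>) = comb g \<alpha> + comb g \<beta>"
  by (simp add: comb_def sum.distrib vector_sadd_rdistrib)

lemma comb_axis [simp]: "comb g (axis i n) = n *s g i"
proof -
  have "comb g (axis i n) = (\<Sum>k\<in>UNIV. if k = i then n *s g k else 0)"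
    unfolding comb_def by (rule sum.cong) (auto simp: axis_def vec_eq_iff)
  then show ?thesis by simp
qed

text \<open>Each \<open>g i\<close> has weight at least 1, so every unit of exponent contributes at
  least 1 to the weight of the degree.\<close>

lemma weight_le_comb:
  assumes "\<And>i. g i \<noteq> 0"
  shows "weight \<alpha> \<le> weight (comb g \<alpha>)"
proof -
  have "weight (comb g \<alpha>) = (\<Sum>i\<in>UNIV. \<alpha> $ i * weight (g i))"
    unfolding comb_def weight_def sum_component sum.swap[of _ "UNIV :: 'a set"]
    by (simp add: sum_distrib_left)
  moreover have "\<alpha> $ i \<le> \<alpha> $ i * weight (g i)" for i
    using assms[of i] by (metis One_nat_def Suc_leI gr0I mult.right_neutral mult_le_mono2 weight_eq_0_iff)
  ultimately show ?thesis by (simp add: weight_def[of \<alpha>] sum_mono)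
qed

lemma sdeg_zero [simp]: "sdeg e a 0 = 0"
  by (simp add: sdeg_def)

lemma sdeg_add: "sdeg e a (u + v) = sdeg e a u + sdeg e a v"
  by (simp add: sdeg_def comb_add add_ac)

section \<open>Indispensable monomials\<close>

text \<open>Says that the fibre of monomials through \<open>u\<close> has a second point. Avoiding
  \<open>card\<close>, which is 0 on infinite sets, postpones the finiteness of fibres to
  \<open>card_monos_of_deg\<close>.\<close>

definition ambiguous ::
    "('t::finite \<Rightarrow> nat^'p) \<Rightarrow> ('r::finite \<Rightarrow> nat^'p) \<Rightarrow> ('t, 'r) mono \<Rightarrow> bool" where
  "ambiguous e a u \<longleftrightarrow> (\<exists>v. v \<noteq> u \<and> sdeg e a v = sdeg e a u)"

definition minimal_ambiguous ::
    "('t::finite \<Rightarrow> nat^'p) \<Rightarrow> ('r::finite \<Rightarrow> nat^'p) \<Rightarrow> ('t, 'r) mono \<Rightarrow> bool" where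
  "minimal_ambiguous e a u \<longleftrightarrow>
     ambiguous e a u \<and> (\<forall>v w. u = v + w \<longrightarrow> ambiguous e a v \<longrightarrow> w = 0)"

lemma ambiguousI: "v \<noteq> u \<Longrightarrow> sdeg e a v = sdeg e a u \<Longrightarrow> ambiguous e a u"
  unfolding ambiguous_def by blast

lemma ambiguous_add:
  assumes "ambiguous e a u"
  shows "ambiguous e a (u + w)"
proof -
  obtain v where "v \<noteq> u" "sdeg e a v = sdeg e a u" using assms unfolding ambiguous_def by blast
  then show ?thesis by (intro ambiguousI[of "v + w"]) (simp_all add: sdeg_add)
qed

text \<open>Ambiguity passes to multiples, so a proper ambiguous divisor can be enlarged until only
  one variable is missing. It suffices to test the divisors obtained by removing a single
  variable.\<close>

lemma minimal_ambiguousI: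
  assumes "ambiguous e a u"
    and "\<And>v k. u = v + (axis k 1, 0) \<Longrightarrow> \<not> ambiguous e a v"
    and "\<And>v k. u = v + (0, axis k 1) \<Longrightarrow> \<not> ambiguous e a v"
  shows "minimal_ambiguous e a u"
  unfolding minimal_ambiguous_def
proof (intro conjI allI impI)
  fix v w assume u: "u = v + w" and v: "ambiguous e a v"
  show "w = 0"
  proof (rule ccontr)
    assume "w \<noteq> 0"
    then show False
    proof (cases rule: mono_split_axis)
      case (X k w')
      then show False using assms(2)[of "v + w'" k] u ambiguous_add[OF v, of w'] by (simp add: add.assoc)
    next
      case (Y k w')
      then show False using assms(3)[of "v + w'" k] u ambiguous_add[OF v, of w'] by (simp add: add.assoc)
    qed
  qed
qed (rule assms(1))

lemma minimal_ambiguousD: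
  "minimal_ambiguous e a u \<Longrightarrow> u = v + w \<Longrightarrow> ambiguous e a v \<Longrightarrow> w = 0"
  unfolding minimal_ambiguous_def by blast

section \<open>Binomials and finite generation of the semigroup ideal\<close>

abbreviation binom :: "('t::finite, 'r::finite) mono \<Rightarrow> ('t, 'r) mono \<Rightarrow> ('t, 'r, 'k::field) mpol" where
  "binom u v \<equiv> Poly_Mapping.single u 1 - Poly_Mapping.single v 1"

lemma binom_in_binomials:
  "sdeg e a u = sdeg e a v \<Longrightarrow> (binom u v :: ('t::finite, 'r::finite, 'k::field) mpol) \<in> binomials e a"
  unfolding binomials_def by blast

lemma keys_binom:
  "Poly_Mapping.keys (binom u v :: ('t::finite, 'r::finite, 'k::field) mpol) = (if u = v then {} else {u, v})"
  by (auto simp: in_keys_iff lookup_minus lookup_single when_def split: if_splits)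

text \<open>The two summands telescope through the intermediate monomial
  \<open>v + s\<close>.\<close>

lemma binom_add:
  "(binom (u + s) (v + t) :: ('t::finite, 'r::finite, 'k::field) mpol) =
     Poly_Mapping.single s 1 * binom u v + Poly_Mapping.single v 1 * binom s t"
  by (simp add: algebra_simps mult_single)

text \<open>Dickson's lemma is applied to pairs of monomials of equal degree: if \<open>(u, v)\<close> is divisible by
  such a pair \<open>(u', v')\<close>, then the quotient \<open>(s, t)\<close> is again such a pair, and \<open>u - v\<close> is a
  combination of \<open>u' - v'\<close> and \<open>s - t\<close>. No monomial order is needed.\<close>

lemma semigroup_ideal_finitely_generated:
  "\<exists>F \<subseteq> binomials e a. finite F \<and>
     ideal_gen F = (semigroup_ideal e a :: ('t::finite, 'r::finite, 'k::field) mpol set)"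
proof -
  define P where "P = {p. fst p \<noteq> snd p \<and> sdeg e a (fst p) = sdeg e a (snd p)}"
  define M where "M = {p \<in> P. \<forall>q\<in>P. \<forall>w. p = q + w \<longrightarrow> w = 0}"
  define F where "F = (\<lambda>(u, v). binom u v :: ('t, 'r, 'k) mpol) ` M"
  define size where "size = (\<lambda>((\<alpha>, \<beta>), (\<gamma>, \<delta>)).
    weight (\<alpha> :: nat^'t) + weight (\<beta> :: nat^'r) + weight (\<gamma> :: nat^'t) + weight (\<delta> :: nat^'r))"
  have size_add: "size (p + q) = size p + size q" for p q
    by (auto simp: size_def weight_add split: prod.splits)
  have size_0: "size p = 0 \<longleftrightarrow> p = 0" for p
    by (auto simp: size_def zero_prod_def split: prod.splits)
  have *: "binom (fst p) (snd p) \<in> ideal_gen F" if "p \<in> P" for p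
    using that
  proof (induction "size p" arbitrary: p rule: less_induct)
    case less
    show ?case
    proof (cases "p \<in> M")
      case True
      then have "binom (fst p) (snd p) \<in> F" by (auto simp: F_def split: prod.splits)
      then show ?thesis using ideal_gen_superset by blast
    next
      case False
      then obtain q w where q: "q \<in> P" and p: "p = q + w" and w: "w \<noteq> 0"
        using less.prems unfolding M_def by blast
      \<comment> \<open>The components of a pair in \<open>P\<close> differ, so \<open>q\<close> is
        nonzero and \<open>w\<close> is strictly smaller than \<open>p\<close>. The components of
        \<open>w\<close> may coincide; its binomial is then 0.\<close>
      have "q \<noteq> 0" using q by (auto simp: P_def zero_prod_def)
      then have sizes: "size q < size p" "size w < size p"
        using w size_0[of q] size_0[of w] by (simp_all add: p size_add)
      have "sdeg e a (fst w) = sdeg e a (snd w)"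
        using less.prems q unfolding P_def p by (auto simp: sdeg_add)
      then have "binom (fst w) (snd w) \<in> ideal_gen F"
        using less.hyps[OF sizes(2)]
        by (cases "fst w = snd w") (auto simp: P_def ideal_gen_def ring_module.span_zero)
      then show ?thesis
        unfolding p fst_add snd_add binom_add
        by (intro ideal_gen_add ideal_gen_mult less.hyps[OF sizes(1) q])
    qed
  qed
  have "binomials e a \<subseteq> ideal_gen F"
  proof
    fix b :: "('t, 'r, 'k) mpol" assume "b \<in> binomials e a"
    then obtain u v where "b = binom u v" "sdeg e a u = sdeg e a v"
      unfolding binomials_def by blast
    then show "b \<in> ideal_gen F"
      using *[of "(u, v)"] by (cases "u = v") (auto simp: P_def ideal_gen_def ring_module.span_zero)
  qed
  moreover have "F \<subseteq> binomials e a"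
    by (auto simp: F_def M_def P_def split_beta simp del: split_paired_All split_paired_Ex
        intro!: binom_in_binomials)
  moreover have "finite F"
    unfolding F_def M_def by (intro finite_imageI finite_divisibility_minimal)
  ultimately show ?thesis
    unfolding semigroup_ideal_def
    using ideal_gen_least[of "binomials e a" F] ideal_gen_mono[of F "binomials e a"] by blast
qed

lemma minimal_ambiguous_imp_indispensable:
  fixes e :: "'t::finite \<Rightarrow> nat^'p" and a :: "'r::finite \<Rightarrow> nat^'p"
  assumes "minimal_ambiguous e a u"
  shows "indispensable TYPE('k::field) e a u"
  unfolding indispensable_def
proof (intro allI impI)
  fix B :: "('t, 'r, 'k) mpol set"
  assume B: "B \<subseteq> binomials e a \<and> minimal_gens ideal_gen (semigroup_ideal e a) B"
  obtain v where v: "v \<noteq> u" "sdeg e a v = sdeg e a u"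
    using assms unfolding minimal_ambiguous_def ambiguous_def by blast
  then have "binom u v \<in> (semigroup_ideal e a :: ('t, 'r, 'k) mpol set)"
    unfolding semigroup_ideal_def
    by (intro subsetD[OF ideal_gen_superset] binom_in_binomials) simp
  then have "(binom u v :: ('t, 'r, 'k) mpol) \<in> ideal_gen B"
    using B by (simp add: minimal_gens_def)
  moreover have "u \<in> Poly_Mapping.keys (binom u v :: ('t, 'r, 'k) mpol)"
    using v by (simp add: keys_binom)
  ultimately obtain b x w where b: "b \<in> B" and x: "x \<in> Poly_Mapping.keys b" and u: "u = x + w"
    using keys_ideal_gen by blast
  obtain y z where "b = binom y z" "sdeg e a y = sdeg e a z"
    using b B unfolding binomials_def by blast
  \<comment> \<open>The other monomial of \<open>b\<close> witnesses that \<open>x\<close> is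
    ambiguous, so minimality of \<open>u\<close> leaves only the trivial cofactor.\<close>
  then have "ambiguous e a x"
    using x by (auto simp: keys_binom split: if_splits intro: ambiguousI)
  then have "w = 0" using minimal_ambiguousD[OF assms u] by blast
  then show "\<exists>b\<in>B. u \<in> Poly_Mapping.keys b" using b x u by auto
qed

section \<open>Gradings by nonzero degrees: finite fibres and the characterisation of
  indispensability\<close>

locale positive_grading =
  fixes e :: "'t::finite \<Rightarrow> nat^'p" and a :: "'r::finite \<Rightarrow> nat^'p"
  assumes e_nonzero: "e i \<noteq> 0" and a_nonzero: "a j \<noteq> 0"
begin

lemma weight_le_sdeg: "weight (fst u) + weight (snd u) \<le> weight (sdeg e a u)"
  unfolding sdeg_def weight_add
  by (intro add_mono weight_le_comb e_nonzero a_nonzero)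

lemma sdeg_eq_0_iff [simp]: "sdeg e a u = 0 \<longleftrightarrow> u = 0"
proof
  assume "sdeg e a u = 0"
  then have "weight (fst u) = 0 \<and> weight (snd u) = 0" using weight_le_sdeg[of u] by simp
  then show "u = 0" by (simp add: prod_eq_iff)
qed simp

lemma finite_monos_of_deg: "finite (monos_of_deg e a m)"
proof (rule finite_subset)
  show "monos_of_deg e a m \<subseteq> {v. weight v \<le> weight m} \<times> {v. weight v \<le> weight m}"
  proof
    fix u assume "u \<in> monos_of_deg e a m"
    then show "u \<in> {v. weight v \<le> weight m} \<times> {v. weight v \<le> weight m}"
      using weight_le_sdeg[of u] by (simp add: monos_of_deg_def mem_Times_iff)
  qed
qed (simp add: finite_weight_le)

text \<open>The fibre is finite and contains \<open>u\<close>, so its cardinality is positive, and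
  it equals 1 exactly when \<open>u\<close> is alone. This turns the conditions defining
  \<open>T_set\<close> and \<open>T'_set\<close> into statements about ambiguity.\<close>

lemma card_monos_of_deg:
  shows card_monos_ge_2_iff: "2 \<le> card (monos_of_deg e a (sdeg e a u)) \<longleftrightarrow> ambiguous e a u"
    and card_monos_eq_1_iff: "card (monos_of_deg e a (sdeg e a u)) = 1 \<longleftrightarrow> \<not> ambiguous e a u"
proof -
  let ?C = "monos_of_deg e a (sdeg e a u)"
  have u: "u \<in> ?C" by (simp add: monos_of_deg_def)
  then have "card ?C \<noteq> 0" using finite_monos_of_deg by auto
  moreover have "card ?C = 1 \<longleftrightarrow> ?C = {u}" using u by (auto simp: card_1_singleton_iff)
  moreover have "?C = {u} \<longleftrightarrow> \<not> ambiguous e a u"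
    by (auto simp: monos_of_deg_def ambiguous_def)
  ultimately show "2 \<le> card ?C \<longleftrightarrow> ambiguous e a u" "card ?C = 1 \<longleftrightarrow> \<not> ambiguous e a u"
    by linarith+
qed

text \<open>A minimal generating set chosen among the binomials that avoid \<open>u\<close> then
  shows that \<open>u\<close> is dispensable.\<close>

lemma binomials_avoiding_generate:
  assumes "\<not> minimal_ambiguous e a u"
  shows "ideal_gen {b \<in> binomials e a. u \<notin> Poly_Mapping.keys b} =
    (semigroup_ideal e a :: ('t, 'r, 'k::field) mpol set)" (is "ideal_gen ?B = _")
proof -
  have zero: "0 \<in> ideal_gen ?B"
    unfolding ideal_gen_def by (rule ring_module.span_zero)
  have B: "(binom x y :: ('t, 'r, 'k) mpol) \<in> ideal_gen ?B"
    if "sdeg e a x = sdeg e a y" "x \<noteq> u" "y \<noteq> u" for x y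
    using that
    by (intro subsetD[OF ideal_gen_superset] CollectI conjI binom_in_binomials) (simp_all add: keys_binom)
  have u: "(binom u y :: ('t, 'r, 'k) mpol) \<in> ideal_gen ?B" if y: "sdeg e a u = sdeg e a y" for y
  proof (cases "u = y")
    case True
    then show ?thesis using zero by simp
  next
    case False
    then have "ambiguous e a u" using y by (intro ambiguousI[of y]) auto
    then obtain v w where v: "u = v + w" "ambiguous e a v" "w \<noteq> 0"
      using assms unfolding minimal_ambiguous_def by blast
    then obtain v' where v': "v' \<noteq> v" "sdeg e a v' = sdeg e a v"
      unfolding ambiguous_def by blast
    have "v \<noteq> u" using v(1,3) by auto
    \<comment> \<open>If \<open>v'\<close> were \<open>u = v + w\<close>, comparing degrees would
      give \<open>w\<close> degree 0, hence \<open>w = 0\<close> by positivity of the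
      grading.\<close>
    moreover have "v' \<noteq> u" using v'(2) v(1,3) by (auto simp: sdeg_add)
    ultimately have "Poly_Mapping.single w 1 * binom v v' \<in> ideal_gen ?B"
      using v'(2) by (intro ideal_gen_mult B) auto
    moreover have "binom (v' + w) y \<in> ideal_gen ?B"
      using v' v(1) False y by (intro B) (auto simp: sdeg_add)
    \<comment> \<open>The detour from \<open>u\<close> to \<open>y\<close> runs through
      \<open>v' + w\<close>. It is a legal stop: it has the degree of \<open>u\<close>, and it
      differs from \<open>u\<close> because \<open>v'\<close> differs from \<open>v\<close>.\<close>
    moreover have "binom u y = Poly_Mapping.single w 1 * binom v v' + (binom (v' + w) y :: ('t, 'r, 'k) mpol)"
      by (simp add: v(1) algebra_simps mult_single)
    ultimately show ?thesis by (simp only: ideal_gen_add)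
  qed
  have "binomials e a \<subseteq> ideal_gen ?B"
  proof
    fix b :: "('t, 'r, 'k) mpol" assume "b \<in> binomials e a"
    then obtain x y where b: "b = binom x y" and xy: "sdeg e a x = sdeg e a y"
      unfolding binomials_def by blast
    show "b \<in> ideal_gen ?B"
    proof (cases "y = u")
      case True
      then have "- 1 * binom u x \<in> ideal_gen ?B" using xy by (intro ideal_gen_mult u) simp
      then show ?thesis by (simp add: b True)
    next
      case False
      then show ?thesis using B[OF xy] u[of y] xy by (cases "x = u") (simp_all add: b)
    qed
  qed
  then show ?thesis
    unfolding semigroup_ideal_def
    using ideal_gen_least[of "binomials e a" ?B] ideal_gen_mono[of ?B "binomials e a"] by blast
qed

lemma indispensable_iff: "indispensable TYPE('k::field) e a u \<longleftrightarrow> minimal_ambiguous e a u"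
proof
  assume ind: "indispensable TYPE('k) e a u"
  show "minimal_ambiguous e a u"
  proof (rule ccontr)
    assume "\<not> minimal_ambiguous e a u"
    let ?B = "{b \<in> binomials e a. u \<notin> Poly_Mapping.keys b} :: ('t, 'r, 'k) mpol set"
    have B: "ideal_gen ?B = semigroup_ideal e a"
      by (rule binomials_avoiding_generate) fact
    \<comment> \<open>The set \<open>?B\<close> may be infinite; finite generation of the ideal is
      what allows a minimal generating subset to be extracted from it.\<close>
    obtain F :: "('t, 'r, 'k) mpol set" where "finite F" "ideal_gen F = semigroup_ideal e a"
      using semigroup_ideal_finitely_generated by blast
    then obtain G where G: "G \<subseteq> ?B" "minimal_gens ideal_gen (semigroup_ideal e a) G"
      using minimal_gens_subset_exists[of F ?B] B by auto
    then have "\<exists>b\<in>G. u \<in> Poly_Mapping.keys b"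
      using ind unfolding indispensable_def by blast
    then show False using G(1) by blast
  qed
qed (rule minimal_ambiguous_imp_indispensable)

end

section \<open>Strong affine semigroups\<close>

lemma Suc_scale: "Suc n *s v = v + n *s v" for v :: "nat^'n"
  by (simp add: vec_eq_iff)

lemma Suc_0_scale [simp]: "Suc 0 *s v = v" for v :: "nat^'n"
  by (simp add: vec_eq_iff)

lemma is_submonoid_zero: "is_submonoid S \<Longrightarrow> 0 \<in> S"
  and is_submonoid_add: "is_submonoid S \<Longrightarrow> x \<in> S \<Longrightarrow> y \<in> S \<Longrightarrow> x + y \<in> S"
  by (simp_all add: is_submonoid_def)

lemma is_submonoidI: "0 \<in> S \<Longrightarrow> (\<And>x y. x \<in> S \<Longrightarrow> y \<in> S \<Longrightarrow> x + y \<in> S) \<Longrightarrow> is_submonoid S"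
  by (simp add: is_submonoid_def)

section \<open>Minimal generators and multiplicities of an affine semigroup\<close>

lemma affine_semigroup_submonoid: "affine_semigroup S \<Longrightarrow> is_submonoid S"
  unfolding affine_semigroup_def using is_submonoid_hull by blast

lemma minimal_gens_msg:
  "affine_semigroup S \<Longrightarrow> minimal_gens ((hull) is_submonoid) S (msg S)"
  unfolding msg_def by (rule theI'[OF msg_ex1[OF affine_semigroup_submonoid]])

lemma hull_msg: "affine_semigroup S \<Longrightarrow> is_submonoid hull (msg S) = S"
  using minimal_gens_msg[of S] by (simp add: minimal_gens_def)

lemma msg_subset: "affine_semigroup S \<Longrightarrow> msg S \<subseteq> S"
  using hull_msg hull_subset[of "msg S" is_submonoid] by blast

lemma msg_not_redundant:
  assumes S: "affine_semigroup S" and g: "g \<in> msg S"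
  shows "g \<notin> is_submonoid hull (msg S - {g})"
proof
  assume "g \<in> is_submonoid hull (msg S - {g})"
  then have "msg S \<subseteq> is_submonoid hull (msg S - {g})"
    using hull_subset[of "msg S - {g}" is_submonoid] by blast
  then have "is_submonoid hull msg S \<subseteq> is_submonoid hull (msg S - {g})"
    by (rule hull_minimal) (rule is_submonoid_hull)
  then have "is_submonoid hull (msg S - {g}) = S"
    using hull_mono[of "msg S - {g}" "msg S" is_submonoid] hull_msg[OF S] by auto
  moreover have "msg S - {g} \<subset> msg S" using g by blast
  ultimately show False using minimal_gens_msg[OF S] unfolding minimal_gens_def by blast
qed

lemma zero_notin_msg:
  assumes "affine_semigroup S"
  shows "0 \<notin> msg S"
  using msg_not_redundant[OF assms, of 0] is_submonoid_zero[OF is_submonoid_hull[of "msg S - {0}"]]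
  by blast

text \<open>Elements of \<open>S\<close> lighter than \<open>x + y\<close> are sums of generators
  other than \<open>x + y\<close>. If both summands were nonzero, this would apply to each of them
  and make the generator \<open>x + y\<close> redundant.\<close>

lemma msg_irreducible:
  assumes S: "affine_semigroup S" and g: "x + y \<in> msg S" and xy: "x \<in> S" "y \<in> S"
  shows "x = 0 \<or> y = 0"
proof (rule ccontr)
  assume nz: "\<not> (x = 0 \<or> y = 0)"
  let ?H = "is_submonoid hull (msg S - {x + y})"
  \<comment> \<open>The weight bound is a premise inside the claim so that the elements satisfying
    it form a submonoid: summands are no heavier than their sum.\<close>
  have *: "weight z < weight (x + y) \<longrightarrow> z \<in> ?H" if "z \<in> S" for z
  proof -
    have "z \<in> is_submonoid hull (msg S)" using that hull_msg[OF S] by simp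
    then show ?thesis
    proof (rule hull_induct)
      fix g assume "g \<in> msg S"
      then show "weight g < weight (x + y) \<longrightarrow> g \<in> ?H" by (auto intro: hull_inc)
    next
      show "is_submonoid {z. weight z < weight (x + y) \<longrightarrow> z \<in> ?H}"
        by (rule is_submonoidI)
          (auto simp: weight_add intro: is_submonoid_zero is_submonoid_add is_submonoid_hull)
    qed
  qed
  have "0 < weight x" "0 < weight y" using nz by (metis gr0I weight_eq_0_iff)+
  then have "x \<in> ?H" "y \<in> ?H" using * xy by (simp_all add: weight_add)
  then have "x + y \<in> ?H" by (rule is_submonoid_add[OF is_submonoid_hull])
  then show False using msg_not_redundant[OF S g] by blast
qed

text \<open>Shows that the cone order extends the order given by differences in \<open>S\<close>.
  Finiteness matters because \<open>cone_pts\<close> is defined by a sum over \<open>msg S\<close>,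
  and infinite sums are 0 by convention.\<close>

lemma subset_cone_pts:
  assumes S: "affine_semigroup S" and fin: "finite (msg S)"
  shows "S \<subseteq> cone_pts S"
proof -
  have "is_submonoid hull (msg S) \<subseteq> cone_pts S"
  proof (rule hull_minimal)
    show "msg S \<subseteq> cone_pts S"
    proof
      fix g assume g: "g \<in> msg S"
      have "(\<Sum>h\<in>msg S. (if h = g then 1 else 0) *\<^sub>R real_vec h) = (\<Sum>h\<in>msg S. if h = g then real_vec h else 0)"
        by (rule sum.cong) auto
      then have "real_vec g = (\<Sum>h\<in>msg S. (if h = g then 1 else 0) *\<^sub>R real_vec h)"
        using g fin by simp
      then show "g \<in> cone_pts S"
        unfolding cone_pts_def by (intro CollectI exI[of _ "\<lambda>h. if h = g then 1 else 0"]) simp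
    qed
    show "is_submonoid (cone_pts S)"
      unfolding is_submonoid_def
    proof (intro conjI ballI)
      show "0 \<in> cone_pts S"
        unfolding cone_pts_def
        by (intro CollectI exI[of _ "\<lambda>_. 0"]) (simp add: real_vec_def vec_eq_iff)
      fix x y assume "x \<in> cone_pts S" "y \<in> cone_pts S"
      then obtain c d where c: "\<forall>g\<in>msg S. 0 \<le> c g" "real_vec x = (\<Sum>g\<in>msg S. c g *\<^sub>R real_vec g)"
        and d: "\<forall>g\<in>msg S. 0 \<le> d g" "real_vec y = (\<Sum>g\<in>msg S. d g *\<^sub>R real_vec g)"
        unfolding cone_pts_def by blast
      have "real_vec (x + y) = real_vec x + real_vec y"
        by (simp add: real_vec_def vec_eq_iff)
      then have "real_vec (x + y) = (\<Sum>g\<in>msg S. (c g + d g) *\<^sub>R real_vec g)"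
        by (simp add: c(2) d(2) sum.distrib scaleR_add_left)
      then show "x + y \<in> cone_pts S"
        unfolding cone_pts_def using c(1) d(1)
        by (intro CollectI exI[of _ "\<lambda>g. c g + d g"]) simp
    qed
  qed
  then show ?thesis using hull_msg[OF S] by simp
qed

text \<open>In a splitting of \<open>m\<close> into two nonzero elements of \<open>S\<close>, each
  summand would lie strictly below \<open>m\<close> in the cone order. So \<open>m\<close> is
  irreducible, and an irreducible element must be a generator.\<close>

lemma Mult_subset_msg:
  assumes S: "affine_semigroup S" and fin: "finite (msg S)"
  shows "Mult S \<subseteq> msg S"
proof
  fix m assume m: "m \<in> Mult S"
  then have mS: "m \<in> S" "m \<noteq> 0" by (auto simp: Mult_def min_elems_def)
  have irred: "x = 0 \<or> y = 0" if "x \<in> S" "y \<in> S" "m = x + y" for x y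
  proof (rule ccontr)
    assume nz: "\<not> (x = 0 \<or> y = 0)"
    have "y \<in> cone_pts S" using subset_cone_pts[OF S fin] that(2) by blast
    then have "cone_le S x m" using that(3) by (auto simp: cone_le_def diff_mem_def)
    then have "x = m" using m nz that(1) by (simp add: Mult_def min_elems_def)
    then show False using nz that(3) by simp
  qed
  have "m \<in> is_submonoid hull (msg S)" using mS(1) hull_msg[OF S] by simp
  \<comment> \<open>The induction predicate is closed under sums: if a sum equals \<open>m\<close>,
    irreducibility makes one summand 0 and the other \<open>m\<close>.\<close>
  then have "m \<in> S \<and> (m = m \<longrightarrow> m \<in> msg S)"
  proof (rule hull_induct[where P = "\<lambda>x. x \<in> S \<and> (x = m \<longrightarrow> m \<in> msg S)"])
    fix g assume "g \<in> msg S"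
    then show "g \<in> S \<and> (g = m \<longrightarrow> m \<in> msg S)" using msg_subset[OF S] by blast
  next
    show "is_submonoid {x. x \<in> S \<and> (x = m \<longrightarrow> m \<in> msg S)}"
      unfolding is_submonoid_def
    proof (intro conjI ballI)
      show "0 \<in> {x. x \<in> S \<and> (x = m \<longrightarrow> m \<in> msg S)}"
        using mS(2) is_submonoid_zero[OF affine_semigroup_submonoid[OF S]] by simp
      fix x y
      assume xy: "x \<in> {x. x \<in> S \<and> (x = m \<longrightarrow> m \<in> msg S)}" "y \<in> {x. x \<in> S \<and> (x = m \<longrightarrow> m \<in> msg S)}"
      then have "x + y \<in> S" using is_submonoid_add[OF affine_semigroup_submonoid[OF S]] by simp
      moreover have "m \<in> msg S" if "x + y = m" using irred[of x y] xy that by auto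
      ultimately show "x + y \<in> {x. x \<in> S \<and> (x = m \<longrightarrow> m \<in> msg S)}" by simp
    qed
  qed
  then show "m \<in> msg S" by simp
qed

section \<open>Divisors of monomials and Hilbert sets\<close>

lemma axis_Suc_eq_add_axis:
  assumes "axis j (Suc n) = \<beta> + axis k 1"
  shows "k = j \<and> \<beta> = axis j n"
proof -
  have *: "axis j (Suc n) $ i = \<beta> $ i + axis k 1 $ i" for i
    unfolding assms by simp
  have "k = j" using *[of k] by (auto simp: axis_def split: if_splits)
  moreover have "axis j (Suc n) = axis j n + axis j 1"
    by (simp add: vec_eq_iff axis_def)
  ultimately show ?thesis using assms by simp
qed

lemma axis_add_axis_eq_add_axis:
  assumes "axis i 1 + axis j 1 = \<beta> + (axis k 1 :: nat^'n)"
  shows "\<beta> = axis i 1 \<or> \<beta> = axis j 1"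
proof -
  have "(axis i 1 + axis j 1 :: nat^'n) $ k = \<beta> $ k + 1"
    unfolding assms by simp
  then have "k = i \<or> k = j" by (auto simp: axis_def split: if_splits)
  then show ?thesis using assms by (metis add.commute add_left_imp_eq)
qed

lemma Y_monomial_not_multiple_of_X: "(0, \<beta>) \<noteq> (v :: ('t::finite, 'r::finite) mono) + (axis k 1, 0)"
proof
  assume "(0, \<beta>) = v + (axis k 1, 0)"
  then have "fst v + axis k 1 = 0" by (simp add: prod_eq_iff)
  then show False by (simp add: nat_vec_add_eq_0_iff axis_eq_0_iff)
qed

text \<open>Componentwise order is divisibility, with the exact difference as cofactor. An ambiguous
  monomial dividing \<open>u\<close> thus identifies \<open>u\<close>.\<close>

lemma minimal_ambiguous_eqI:
  assumes "minimal_ambiguous e a u" "ambiguous e a v" "fst v \<le> fst u" "snd v \<le> snd u"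
  shows "u = v"
proof -
  have "u = v + (fst u - fst v, snd u - snd v)"
    using assms(3,4) by (simp add: prod_eq_iff vec_eq_iff less_eq_vec_def)
  then show ?thesis using minimal_ambiguousD[OF assms(1) _ assms(2)] by (metis add.right_neutral)
qed

text \<open>Removing \<open>y_j\<close> must destroy ambiguity, which is the second condition in the
  set; removing an x-variable must destroy it too, which is minimality of \<omega>. The cases
  \<open>n = 0\<close> and \<open>n = 1\<close> give \<open>T_set\<close> and
  \<open>T'_set\<close>.\<close>

lemma minimal_ambiguous_iff_Hilb:
  "minimal_ambiguous e a (\<omega>, axis j (Suc n)) \<longleftrightarrow>
     \<omega> \<in> Hilb {\<alpha>. ambiguous e a (\<alpha>, axis j (Suc n)) \<and> \<not> ambiguous e a (\<alpha>, axis j n)}"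
    (is "?min \<longleftrightarrow> \<omega> \<in> Hilb ?L")
proof
  assume min: ?min
  have "(\<omega>, axis j (Suc n)) = (\<omega>, axis j n) + (0, axis j 1)"
    by (simp add: vec_eq_iff axis_def)
  then have "\<not> ambiguous e a (\<omega>, axis j n)"
    using minimal_ambiguousD[OF min] by (metis axis_eq_0_iff prod.inject zero_neq_one zero_prod_def)
  then have "\<omega> \<in> ?L" using min by (simp add: minimal_ambiguous_def)
  moreover have "\<alpha> = \<omega>" if "\<alpha> \<in> ?L" "\<alpha> \<le> \<omega>" for \<alpha>
    using minimal_ambiguous_eqI[OF min, of "(\<alpha>, axis j (Suc n))"] that by simp
  ultimately show "\<omega> \<in> Hilb ?L" by (simp add: Hilb_def min_elems_def)
next
  assume "\<omega> \<in> Hilb ?L"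
  then have \<omega>: "\<omega> \<in> ?L" and min: "\<And>\<alpha>. \<alpha> \<in> ?L \<Longrightarrow> \<alpha> \<le> \<omega> \<Longrightarrow> \<alpha> = \<omega>"
    by (auto simp: Hilb_def min_elems_def)
  show ?min
  proof (rule minimal_ambiguousI)
    fix v k assume "(\<omega>, axis j (Suc n)) = v + (axis k 1, 0)"
    then have v: "\<omega> = fst v + axis k 1" "v = (fst v, axis j (Suc n))"
      by (simp_all add: prod_eq_iff)
    \<comment> \<open>Divisors of an unambiguous monomial are unambiguous, so an ambiguous
      \<open>v\<close> would put the smaller exponent \<open>fst v\<close> into the set.\<close>
    then have "\<not> ambiguous e a (fst v, axis j n)"
      using \<omega> ambiguous_add[of e a "(fst v, axis j n)" "(axis k 1, 0)"] by auto
    moreover have "fst v \<noteq> \<omega>" using v(1) by (simp add: axis_eq_0_iff)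
    moreover have "fst v \<le> \<omega>" using v(1) by (simp add: less_eq_vec_def)
    ultimately show "\<not> ambiguous e a v" using min[of "fst v"] v(2) by auto
  next
    fix v k assume "(\<omega>, axis j (Suc n)) = v + (0, axis k 1)"
    then have "v = (\<omega>, axis j n)"
      using axis_Suc_eq_add_axis[of j n "snd v" k] by (simp add: prod_eq_iff)
    then show "\<not> ambiguous e a v" using \<omega> by simp
  qed (use \<omega> in simp)
qed

context positive_grading
begin

lemma T_set_eq: "T_set e a j = {\<alpha>. ambiguous e a (\<alpha>, axis j (Suc 0)) \<and> \<not> ambiguous e a (\<alpha>, axis j 0)}"
proof -
  have "2 \<le> card (monos_of_deg e a (comb e \<alpha> + a j)) \<longleftrightarrow> ambiguous e a (\<alpha>, axis j (Suc 0))"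
    and "card (monos_of_deg e a (comb e \<alpha>)) = 1 \<longleftrightarrow> \<not> ambiguous e a (\<alpha>, axis j 0)" for \<alpha>
    using card_monos_ge_2_iff[of "(\<alpha>, axis j (Suc 0))"] card_monos_eq_1_iff[of "(\<alpha>, axis j 0)"]
    by (simp_all add: sdeg_def)
  then show ?thesis unfolding T_set_def by simp
qed

lemma T'_set_eq: "T'_set e a j = {\<alpha>. ambiguous e a (\<alpha>, axis j (Suc 1)) \<and> \<not> ambiguous e a (\<alpha>, axis j 1)}"
proof -
  have "2 \<le> card (monos_of_deg e a (comb e \<alpha> + 2 *s a j)) \<longleftrightarrow> ambiguous e a (\<alpha>, axis j (Suc 1))"
    and "card (monos_of_deg e a (comb e \<alpha> + a j)) = 1 \<longleftrightarrow> \<not> ambiguous e a (\<alpha>, axis j 1)" for \<alpha>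
    using card_monos_ge_2_iff[of "(\<alpha>, axis j (Suc 1))"] card_monos_eq_1_iff[of "(\<alpha>, axis j 1)"]
    by (simp_all add: sdeg_def numeral_2_eq_2)
  then show ?thesis unfolding T'_set_def by simp
qed

end

section \<open>Which monomials in the y-variables are ambiguous when the semigroup is strong\<close>

locale strong_semigroup =
  fixes S :: "(nat^'p) set" and e :: "'t::finite \<Rightarrow> nat^'p" and a :: "'r::finite \<Rightarrow> nat^'p"
  assumes affine: "affine_semigroup S" and strong: "strong S"
    and range_e: "range e = Mult S"
    and inj_a: "inj a" and range_a: "range a = msg S - Mult S"
begin

lemma range_e_Un_range_a: "range e \<union> range a = msg S"
proof -
  have "finite (range e \<union> range a)" by simp
  \<comment> \<open>This inclusion holds before multiplicities are known to be generators, and it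
    supplies the finiteness from which that fact follows.\<close>
  moreover have "msg S \<subseteq> range e \<union> range a" using range_e range_a by blast
  ultimately have "finite (msg S)" by (rule finite_subset[rotated])
  then have "Mult S \<subseteq> msg S" by (rule Mult_subset_msg[OF affine])
  then show ?thesis using range_e range_a by blast
qed

lemma generators_in_msg: "e i \<in> msg S" "a j \<in> msg S"
  using range_e_Un_range_a by blast+

lemma generators_in_S: "e i \<in> S" "a j \<in> S"
  using generators_in_msg msg_subset[OF affine] by blast+

sublocale positive_grading e a
  by standard (metis generators_in_msg zero_notin_msg[OF affine])+

lemma S_zero: "0 \<in> S"
  and S_add: "x \<in> S \<Longrightarrow> y \<in> S \<Longrightarrow> x + y \<in> S"
  using affine_semigroup_submonoid[OF affine] by (auto simp: is_submonoid_def)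

lemma S_scale: "x \<in> S \<Longrightarrow> n *s x \<in> S"
  by (induction n) (simp_all add: Suc_scale S_zero S_add)

lemma comb_in_S: "(\<And>i. g i \<in> S) \<Longrightarrow> comb g \<alpha> \<in> S"
proof -
  assume g: "\<And>i. g i \<in> S"
  have "(\<Sum>i\<in>I. \<alpha> $ i *s g i) \<in> S" for I
    by (induction I rule: infinite_finite_induct) (simp_all add: S_zero S_add S_scale g)
  then show ?thesis by (simp add: comb_def)
qed

lemma range_sdeg: "range (sdeg e a) = S"
proof
  show "range (sdeg e a) \<subseteq> S"
    by (auto simp: sdeg_def intro!: S_add comb_in_S generators_in_S)
  have "is_submonoid hull (msg S) \<subseteq> range (sdeg e a)"
  proof (rule hull_minimal)
    have "e i = sdeg e a (axis i 1, 0)" "a j = sdeg e a (0, axis j 1)" for i j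
      by (simp_all add: sdeg_def)
    then show "msg S \<subseteq> range (sdeg e a)" unfolding range_e_Un_range_a[symmetric] by blast
    show "is_submonoid (range (sdeg e a))"
    proof (rule is_submonoidI)
      show "0 \<in> range (sdeg e a)" using sdeg_zero[of e a] by (metis rangeI)
      fix x y assume "x \<in> range (sdeg e a)" "y \<in> range (sdeg e a)"
      then show "x + y \<in> range (sdeg e a)" by (auto simp flip: sdeg_add)
    qed
  qed
  then show "S \<subseteq> range (sdeg e a)" using hull_msg[OF affine] by simp
qed

lemma sdeg_in_S: "sdeg e a u \<in> S"
  unfolding range_sdeg[symmetric] by simp

lemma sdeg_X: "sdeg e a (axis i n, 0) = n *s e i" and sdeg_Y: "sdeg e a (0, axis j n) = n *s a j"
  by (simp_all add: sdeg_def)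

text \<open>The degree \<open>a j\<close> is an irreducible generator, so a monomial of this degree
  is a single variable. It is no x-variable because \<open>a j\<close> is not a multiplicity, and no
  other y-variable because \<open>a\<close> is injective.\<close>

lemma not_ambiguous_Y: "\<not> ambiguous e a (0, axis j 1)"
proof
  assume "ambiguous e a (0, axis j 1)"
  then obtain v where v: "v \<noteq> (0, axis j 1)" "sdeg e a v = a j"
    unfolding ambiguous_def by (auto simp: sdeg_Y)
  then have "v \<noteq> 0" using a_nonzero[of j] by auto
  have atom: "w = 0 \<and> sdeg e a g = a j" if "v = w + g" "g \<noteq> 0" for w g
  proof -
    have "sdeg e a w + sdeg e a g = a j" using v(2) that(1) by (simp add: sdeg_add)
    then have "sdeg e a w = 0 \<or> sdeg e a g = 0"
      using msg_irreducible[OF affine _ sdeg_in_S sdeg_in_S] generators_in_msg(2)[of j] by metis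
    then show ?thesis using that(2) \<open>sdeg e a w + sdeg e a g = a j\<close> by auto
  qed
  from \<open>v \<noteq> 0\<close> show False
  proof (cases rule: mono_split_axis)
    case (X k w)
    then have "e k = a j" using atom[OF X] by (simp add: sdeg_X zero_prod_def axis_eq_0_iff)
    then show False using range_e range_a by blast
  next
    case (Y k w)
    then have "w = 0" "a k = a j" using atom[OF Y] by (simp_all add: sdeg_Y zero_prod_def axis_eq_0_iff)
    then show False using Y v(1) inj_a by (simp add: inj_eq)
  qed
qed

text \<open>Splitting off the multiplicity gives a monomial of the same degree that contains an
  x-variable, whereas \<open>u\<close> contains none.\<close>

lemma ambiguous_if_diff_mem:
  assumes "m \<in> Mult S" and "diff_mem (sdeg e a u) m S" and "fst u = 0"
  shows "ambiguous e a u"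
proof -
  obtain i where "m = e i" using assms(1) range_e by blast
  moreover obtain w where "sdeg e a u = m + sdeg e a w"
    using assms(2) range_sdeg unfolding diff_mem_def by blast
  ultimately have "sdeg e a ((axis i 1, 0) + w) = sdeg e a u" by (simp add: sdeg_add sdeg_X)
  moreover have "(axis i 1, 0) + w \<noteq> u"
    using assms(3) by (auto simp: prod_eq_iff nat_vec_add_eq_0_iff axis_eq_0_iff)
  ultimately show ?thesis by (intro ambiguousI)
qed

lemma strongE:
  assumes "x \<in> S" "y \<in> S" "x \<noteq> 0" "y \<noteq> 0" "x \<noteq> y"
  obtains m where "m \<in> Mult S" "diff_mem (x + y) m S"
  using strong assms unfolding strong_def by blast

lemma ambiguous_add_Y:
  assumes "fst u = 0" "u \<noteq> 0" "sdeg e a u \<noteq> a j"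
  shows "ambiguous e a (u + (0, axis j 1))"
proof -
  obtain m where "m \<in> Mult S" "diff_mem (sdeg e a u + a j) m S"
    using strongE[of "sdeg e a u" "a j"] sdeg_in_S generators_in_S a_nonzero assms(2,3) by auto
  then show ?thesis
    using assms(1) by (intro ambiguous_if_diff_mem) (simp_all add: sdeg_add sdeg_Y)
qed

lemma ambiguous_Y_Y: "i \<noteq> j \<Longrightarrow> ambiguous e a (0, axis i 1 + axis j 1)"
  using ambiguous_add_Y[of "(0, axis i 1)" j] inj_a
  by (simp add: sdeg_Y inj_eq zero_prod_def axis_eq_0_iff)

text \<open>Strongness applies to the distinct elements \<open>2 *s a i\<close> and
  \<open>a i\<close>. For the square the two summands coincide, hence the dependence on the Apery
  set there.\<close>

lemma ambiguous_cube: "ambiguous e a (0, axis i 3)"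
proof -
  have "2 *s a i \<noteq> a i" using a_nonzero[of i] by (auto simp: vec_eq_iff)
  then have "ambiguous e a ((0, axis i 2) + (0, axis i 1))"
    by (intro ambiguous_add_Y) (simp_all add: sdeg_Y zero_prod_def axis_eq_0_iff)
  moreover have "(0, axis i 2) + (0, axis i 1) = (0 :: nat^'t, axis i 3 :: nat^'r)"
    by (simp add: vec_eq_iff axis_def)
  ultimately show ?thesis by simp
qed

text \<open>If \<open>2 *s a i\<close> is in the Apery set, no monomial of that degree contains an
  x-variable. One of the form \<open>y_k w\<close> must have \<open>w\<close> of degree
  \<open>a k\<close>, since strongness would otherwise split off a multiplicity; this forces
  \<open>k = i\<close> and \<open>w = y_i\<close>.\<close>

lemma ambiguous_square_iff: "ambiguous e a (0, axis i 2) \<longleftrightarrow> 2 *s a i \<notin> Ap S (Mult S)"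
proof
  assume "2 *s a i \<notin> Ap S (Mult S)"
  then obtain m where "m \<in> Mult S" "diff_mem (2 *s a i) m S"
    using S_scale generators_in_S unfolding Ap_def by blast
  then show "ambiguous e a (0, axis i 2)"
    by (intro ambiguous_if_diff_mem) (simp_all add: sdeg_Y)
next
  assume "ambiguous e a (0, axis i 2)"
  then obtain v where v: "v \<noteq> (0, axis i 2)" "sdeg e a v = 2 *s a i"
    unfolding ambiguous_def by (auto simp: sdeg_Y)
  have double: "2 *s x = x + x" for x :: "nat^'p" by (simp add: vec_eq_iff)
  show "2 *s a i \<notin> Ap S (Mult S)"
  proof
    assume Ap: "2 *s a i \<in> Ap S (Mult S)"
    have "v \<noteq> 0" using v(2) a_nonzero[of i] by (auto simp: double nat_vec_add_eq_0_iff)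
    then show False
    proof (cases rule: mono_split_axis)
      case (X k w)
      then have "2 *s a i = e k + sdeg e a w"
        using v(2) by (simp add: sdeg_add sdeg_X add.commute)
      then have "diff_mem (2 *s a i) (e k) S" using sdeg_in_S by (auto simp: diff_mem_def)
      then show False using Ap range_e unfolding Ap_def by blast
    next
      case (Y k w)
      then have eq: "sdeg e a w + a k = 2 *s a i" using v(2) by (simp add: sdeg_add sdeg_Y)
      \<comment> \<open>Otherwise the generator \<open>a k\<close> would equal
        \<open>a i + a i\<close>, contradicting irreducibility.\<close>
      have "sdeg e a w \<noteq> 0"
        using eq msg_irreducible[OF affine, of "a i" "a i"] generators_in_msg(2)[of k]
          generators_in_S a_nonzero[of i] by (auto simp: double)
      moreover have "\<not> diff_mem (sdeg e a w + a k) m S" if "m \<in> Mult S" for m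
        using that Ap eq unfolding Ap_def by simp
      ultimately have w: "sdeg e a w = a k"
        using strongE[OF sdeg_in_S[of w] generators_in_S(2)[of k]] a_nonzero[of k] by blast
      \<comment> \<open>Now \<open>eq\<close> reads \<open>2 *s a k = 2 *s a i\<close>, and the
        factor 2 cancels in each component.\<close>
      then have "a k $ l = a i $ l" for l
        using arg_cong[OF eq, of "\<lambda>v. v $ l"] by (simp add: double)
      then have "a k = a i" by (simp add: vec_eq_iff)
      then have "k = i" using inj_a by (simp add: inj_eq)
      then have "w = (0, axis i 1)"
        using ambiguousI[of w "(0, axis i 1)" e a] not_ambiguous_Y[of i] w by (auto simp: sdeg_Y)
      then have "v = (0, axis i 2)" using Y \<open>k = i\<close> by (simp add: vec_eq_iff axis_def)
      then show False using v(1) by simp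
    qed
  qed
qed

section \<open>Minimal ambiguous monomials containing a y-variable\<close>

lemma minimal_ambiguous_Y_Y:
  assumes "ambiguous e a (0, axis i 1 + axis j 1)"
  shows "minimal_ambiguous e a (0, axis i 1 + axis j 1)"
proof (rule minimal_ambiguousI[OF assms])
  fix v :: "('t, 'r) mono" and k assume "(0, axis i 1 + axis j 1) = v + (axis k 1, 0)"
  then show "\<not> ambiguous e a v" by (simp only: Y_monomial_not_multiple_of_X)
next
  fix v :: "('t, 'r) mono" and k assume "(0, axis i 1 + axis j 1) = v + (0, axis k 1)"
  then have "v = (0, axis i 1) \<or> v = (0, axis j 1)"
    using axis_add_axis_eq_add_axis[of i j "snd v" k] by (auto simp: prod_eq_iff)
  then show "\<not> ambiguous e a v" using not_ambiguous_Y by blast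
qed

lemma axis_2_eq: "axis i 2 = axis i 1 + (axis i 1 :: nat^'n)"
  by (simp add: vec_eq_iff axis_def)

lemma minimal_ambiguous_square:
  "2 *s a i \<notin> Ap S (Mult S) \<Longrightarrow> minimal_ambiguous e a (0, axis i 2)"
  using minimal_ambiguous_Y_Y[of i i] ambiguous_square_iff[of i] by (simp add: axis_2_eq)

lemma minimal_ambiguous_cube:
  assumes "2 *s a i \<in> Ap S (Mult S)"
  shows "minimal_ambiguous e a (0, axis i 3)"
proof (rule minimal_ambiguousI[OF ambiguous_cube])
  fix v :: "('t, 'r) mono" and k assume "(0, axis i 3) = v + (axis k 1, 0)"
  then show "\<not> ambiguous e a v" by (simp only: Y_monomial_not_multiple_of_X)
next
  fix v :: "('t, 'r) mono" and k assume "(0, axis i 3) = v + (0, axis k 1)"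
  then have "v = (0, axis i 2)"
    using axis_Suc_eq_add_axis[of i 2 "snd v" k] by (simp add: prod_eq_iff)
  then show "\<not> ambiguous e a v" using assms ambiguous_square_iff by simp
qed

lemma minimal_ambiguous_T:
  "minimal_ambiguous e a (\<omega>, axis j 1) \<longleftrightarrow> \<omega> \<in> Hilb (T_set e a j)"
  using minimal_ambiguous_iff_Hilb[of e a \<omega> j 0] by (simp add: T_set_eq)

lemma minimal_ambiguous_T':
  "minimal_ambiguous e a (\<omega>, axis j 2) \<longleftrightarrow> \<omega> \<in> Hilb (T'_set e a j)"
  using minimal_ambiguous_iff_Hilb[of e a \<omega> j 1] by (simp add: T'_set_eq numeral_2_eq_2)

text \<open>Two different y-variables in \<open>u\<close> make their product an ambiguous divisor,
  hence \<open>u\<close> itself. With a single \<open>y_j\<close> its exponent is at most 3, since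
  the cube is always ambiguous and a larger power would not be minimal; the Apery condition decides
  the role of the square.\<close>

lemma minimal_ambiguous_cases:
  assumes min: "minimal_ambiguous e a u" and j: "snd u $ j \<noteq> 0"
  shows "(\<exists>i j. i \<noteq> j \<and> u = (0, axis i 1 + axis j 1)) \<or>
    (\<exists>i. 2 *s a i \<notin> Ap S (Mult S) \<and> u = (0, axis i 2)) \<or>
    (\<exists>i. 2 *s a i \<in> Ap S (Mult S) \<and> u = (0, axis i 3)) \<or>
    (\<exists>j. \<exists>\<omega>\<in>Hilb (T_set e a j). u = (\<omega>, axis j 1)) \<or>
    (\<exists>j. 2 *s a j \<in> Ap S (Mult S) \<and> (\<exists>\<omega>\<in>Hilb (T'_set e a j). u = (\<omega>, axis j 2)))"
proof (cases "\<exists>i. i \<noteq> j \<and> snd u $ i \<noteq> 0")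
  case True
  then obtain i where i: "i \<noteq> j" "snd u $ i \<noteq> 0" by blast
  then have "u = (0, axis i 1 + axis j 1)"
    using j by (intro minimal_ambiguous_eqI[OF min ambiguous_Y_Y]) (auto simp: less_eq_vec_def axis_def)
  then show ?thesis using i(1) by blast
next
  case False
  define n where "n = snd u $ j"
  have snd_u: "snd u = axis j n" using False by (auto simp: vec_eq_iff axis_def n_def)
  then have u: "u = (fst u, axis j n)" by (simp add: prod_eq_iff)
  have min': "minimal_ambiguous e a (fst u, axis j n)" using min snd_u[symmetric] by simp
  \<comment> \<open>A power of \<open>y_j\<close> that is ambiguous and divides \<open>u\<close>
    leaves no room for x-variables or for further factors \<open>y_j\<close>.\<close>
  have power: "u = (0, axis j k)" if "ambiguous e a (0, axis j k)" "k \<le> n" for k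
    using that by (intro minimal_ambiguous_eqI[OF min]) (auto simp: less_eq_vec_def axis_def snd_u)
  have "n \<noteq> 0" using j by (simp add: n_def)
  then consider "n = 1" | "n \<ge> 2" "2 *s a j \<notin> Ap S (Mult S)"
    | "n = 2" "2 *s a j \<in> Ap S (Mult S)" | "n \<ge> 3" "2 *s a j \<in> Ap S (Mult S)" by linarith
  then show ?thesis
  proof cases
    case 1
    then have "fst u \<in> Hilb (T_set e a j)" using min' minimal_ambiguous_T by simp
    then show ?thesis using u unfolding 1 by blast
  next
    case 2
    then have "u = (0, axis j 2)" by (intro power) (simp_all add: ambiguous_square_iff)
    then show ?thesis using 2(2) by blast
  next
    case 3
    then have "fst u \<in> Hilb (T'_set e a j)" using min' minimal_ambiguous_T' by simp
    then show ?thesis using u 3(2) unfolding 3(1) by blast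
  next
    case 4
    then have "u = (0, axis j 3)" by (intro power ambiguous_cube)
    then show ?thesis using 4(2) by blast
  qed
qed

end

theorem theorem29:
  fixes S :: "(nat^'p) set"
    and e :: "'t::finite \<Rightarrow> nat^'p"
    and a :: "'r::finite \<Rightarrow> nat^'p"
  assumes "affine_semigroup S" and "strong S"
    and "inj e" and "range e = Mult S"
    and "inj a" and "range a = msg S - Mult S" and "msg S - Mult S \<noteq> {}"
  shows
    "(\<forall>i j. i \<noteq> j \<longrightarrow> indispensable TYPE('k::field) e a (0, axis i 1 + axis j 1)) \<and>
     (\<forall>i. 2 *s a i \<notin> Ap S (Mult S) \<longrightarrow> indispensable TYPE('k) e a (0, axis i 2)) \<and>
     (\<forall>i. 2 *s a i \<in> Ap S (Mult S) \<longrightarrow> indispensable TYPE('k) e a (0, axis i 3)) \<and>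
     (\<forall>j. \<forall>\<omega>\<in>Hilb (T_set e a j). indispensable TYPE('k) e a (\<omega>, axis j 1)) \<and>
     (\<forall>j. 2 *s a j \<in> Ap S (Mult S) \<longrightarrow>
        (\<forall>\<omega>\<in>Hilb (T'_set e a j). indispensable TYPE('k) e a (\<omega>, axis j 2))) \<and>
     (\<forall>u. indispensable TYPE('k) e a u \<and> (\<exists>j. snd u $ j \<noteq> 0) \<longrightarrow>
        (\<exists>i j. i \<noteq> j \<and> u = (0, axis i 1 + axis j 1)) \<or>
        (\<exists>i. 2 *s a i \<notin> Ap S (Mult S) \<and> u = (0, axis i 2)) \<or>
        (\<exists>i. 2 *s a i \<in> Ap S (Mult S) \<and> u = (0, axis i 3)) \<or>
        (\<exists>j. \<exists>\<omega>\<in>Hilb (T_set e a j). u = (\<omega>, axis j 1)) \<or>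
        (\<exists>j. 2 *s a j \<in> Ap S (Mult S) \<and> (\<exists>\<omega>\<in>Hilb (T'_set e a j). u = (\<omega>, axis j 2))))"
proof -
  interpret strong_semigroup S e a
    by unfold_locales (rule assms)+
  show ?thesis
    unfolding indispensable_iff
  proof (intro conjI allI impI ballI)
    fix u assume "minimal_ambiguous e a u \<and> (\<exists>j. snd u $ j \<noteq> 0)"
    then obtain j where "minimal_ambiguous e a u" "snd u $ j \<noteq> 0" by blast
    then show "(\<exists>i j. i \<noteq> j \<and> u = (0, axis i 1 + axis j 1)) \<or>
        (\<exists>i. 2 *s a i \<notin> Ap S (Mult S) \<and> u = (0, axis i 2)) \<or>
        (\<exists>i. 2 *s a i \<in> Ap S (Mult S) \<and> u = (0, axis i 3)) \<or>
        (\<exists>j. \<exists>\<omega>\<in>Hilb (T_set e a j). u = (\<omega>, axis j 1)) \<or>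
        (\<exists>j. 2 *s a j \<in> Ap S (Mult S) \<and> (\<exists>\<omega>\<in>Hilb (T'_set e a j). u = (\<omega>, axis j 2)))"
      by (rule minimal_ambiguous_cases)
  qed ((rule minimal_ambiguous_Y_Y[OF ambiguous_Y_Y] minimal_ambiguous_square minimal_ambiguous_cube
      minimal_ambiguous_T[THEN iffD2] minimal_ambiguous_T'[THEN iffD2]; assumption)+)
qed

end
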